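(* Let $h\in\mathbb R[x_1,\ldots,x_n]$ be homogeneous and hyperbolic in direction $e\in\mathbb R^n$, and let $e'\in\mathring{\Lambda}_e(h)$. Then $\mathcal A_{e'}(h)\cong\mathcal A_e(h)$ as unital $*$-algebras.
   Context: A homogeneous polynomial $h\in\mathbb R[x]$ is hyperbolic in direction $e\in\mathbb R^n$ if $h(e)\neq0$ and for every $a\in\mathbb R^n$ the polynomial $h_{a,e}(t):=h(a-te)$ has only real roots; $\mathring\Lambda_e(h)=\{a\in\mathbb R^n: h_{a,e}(t)\text{ has only positive roots}\}$ (it is known that $h$ is then also hyperbolic in every direction $e'\in\mathring\Lambda_e(h)$). For $a\in\mathbb R^n$ write $a\bullet z=a_1z_1+\cdots+a_nz_n$. Let $\mathbb C\langle z_1,\ldots,z_n\rangle$ be the free noncommutative unital algebra with involution determined by $z_i^*=z_i$. For a direction $u$ in which $h$ is hyperbolic, let $J_u(h)$ be the two-sided ideal generated by all $h_{a,u}(a\bullet z)$, $a\in\mathbb R^n$, where $h_{a,u}(t)=h(a-tu)$, together with $1-u\bullet z$, and let $\mathcal A_u(h)=\mathbb C\langle z\rangle/J_u(h)$, a unital $*$-algebra. *)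

theory Defs
  imports "HOL-Analysis.Analysis" "HOL-Computational_Algebra.Polynomial"
begin

definition homogeneous_polynomial :: "(real^'n::finite \<Rightarrow> real) \<Rightarrow> bool" where
  "homogeneous_polynomial h \<longleftrightarrow>
     (\<exists>(d::nat) (S::('n \<Rightarrow> nat) set) (c::('n \<Rightarrow> nat) \<Rightarrow> real).
        finite S \<and> (\<forall>\<alpha>\<in>S. sum \<alpha> UNIV = d) \<and>
        (\<forall>x. h x = (\<Sum>\<alpha>\<in>S. c \<alpha> * (\<Prod>i\<in>UNIV. (x $ i) ^ \<alpha> i))))"

definition hpoly :: "(real^'n::finite \<Rightarrow> real) \<Rightarrow> real^'n \<Rightarrow> real^'n \<Rightarrow> real poly" where
  "hpoly h a u = (THE p. \<forall>t. poly p t = h (a - t *\<^sub>R u))"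

definition only_real_roots :: "real poly \<Rightarrow> bool" where
  "only_real_roots p \<longleftrightarrow> (\<forall>z::complex. poly (map_poly complex_of_real p) z = 0 \<longrightarrow> z \<in> \<real>)"

definition only_positive_roots :: "real poly \<Rightarrow> bool" where
  "only_positive_roots p \<longleftrightarrow>
     (\<forall>z::complex. poly (map_poly complex_of_real p) z = 0 \<longrightarrow> z \<in> \<real> \<and> Re z > 0)"

definition hyperbolic :: "(real^'n::finite \<Rightarrow> real) \<Rightarrow> real^'n \<Rightarrow> bool" where
  "hyperbolic h e \<longleftrightarrow> h e \<noteq> 0 \<and> (\<forall>a. only_real_roots (hpoly h a e))"

definition hyp_cone_interior :: "(real^'n::finite \<Rightarrow> real) \<Rightarrow> real^'n \<Rightarrow> (real^'n) set" where
  "hyp_cone_interior h e = {a. only_positive_roots (hpoly h a e)}"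

text \<open>Elements are finitely supported functions from words ('n list) to complex
  coefficients; the word [i1,...,ik] stands for z_i1 ... z_ik.\<close>
definition FA :: "('n list \<Rightarrow> complex) set" where
  "FA = {f. finite {w. f w \<noteq> 0}}"

definition fa_zero :: "'n list \<Rightarrow> complex" where "fa_zero = (\<lambda>w. 0)"
definition fa_one :: "'n list \<Rightarrow> complex" where "fa_one = (\<lambda>w. if w = [] then 1 else 0)"
definition fa_var :: "'n \<Rightarrow> 'n list \<Rightarrow> complex" where
  "fa_var i = (\<lambda>w. if w = [i] then 1 else 0)"
definition fa_add :: "('n list \<Rightarrow> complex) \<Rightarrow> ('n list \<Rightarrow> complex) \<Rightarrow> 'n list \<Rightarrow> complex" where
  "fa_add f g = (\<lambda>w. f w + g w)"
definition fa_sub :: "('n list \<Rightarrow> complex) \<Rightarrow> ('n list \<Rightarrow> complex) \<Rightarrow> 'n list \<Rightarrow> complex" where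
  "fa_sub f g = (\<lambda>w. f w - g w)"
definition fa_smult :: "complex \<Rightarrow> ('n list \<Rightarrow> complex) \<Rightarrow> 'n list \<Rightarrow> complex" where
  "fa_smult c f = (\<lambda>w. c * f w)"
definition fa_mult :: "('n list \<Rightarrow> complex) \<Rightarrow> ('n list \<Rightarrow> complex) \<Rightarrow> 'n list \<Rightarrow> complex" where
  "fa_mult f g = (\<lambda>w. \<Sum>k\<le>length w. f (take k w) * g (drop k w))"
text \<open>Involution: conjugate-linear, anti-multiplicative, z_i^* = z_i.\<close>
definition fa_star :: "('n list \<Rightarrow> complex) \<Rightarrow> 'n list \<Rightarrow> complex" where
  "fa_star f = (\<lambda>w. cnj (f (rev w)))"

fun fa_pow :: "('n list \<Rightarrow> complex) \<Rightarrow> nat \<Rightarrow> 'n list \<Rightarrow> complex" where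
  "fa_pow f 0 = fa_one"
| "fa_pow f (Suc k) = fa_mult f (fa_pow f k)"

definition fa_lin :: "real^'n::finite \<Rightarrow> 'n list \<Rightarrow> complex" where
  "fa_lin a = (\<lambda>w. \<Sum>i\<in>UNIV. complex_of_real (a $ i) * fa_var i w)"

definition fa_poly_eval :: "real poly \<Rightarrow> ('n list \<Rightarrow> complex) \<Rightarrow> 'n list \<Rightarrow> complex" where
  "fa_poly_eval p f = (\<lambda>w. \<Sum>k\<le>degree p. complex_of_real (coeff p k) * fa_pow f k w)"

inductive_set fa_ideal :: "('n list \<Rightarrow> complex) set \<Rightarrow> ('n list \<Rightarrow> complex) set"
  for S :: "('n list \<Rightarrow> complex) set" where
  gen: "f \<in> S \<Longrightarrow> f \<in> fa_ideal S"
| zero: "fa_zero \<in> fa_ideal S"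
| add: "f \<in> fa_ideal S \<Longrightarrow> g \<in> fa_ideal S \<Longrightarrow> fa_add f g \<in> fa_ideal S"
| smult: "f \<in> fa_ideal S \<Longrightarrow> fa_smult c f \<in> fa_ideal S"
| mult_left: "f \<in> fa_ideal S \<Longrightarrow> g \<in> FA \<Longrightarrow> fa_mult g f \<in> fa_ideal S"
| mult_right: "f \<in> fa_ideal S \<Longrightarrow> g \<in> FA \<Longrightarrow> fa_mult f g \<in> fa_ideal S"

definition J_ideal :: "(real^'n::finite \<Rightarrow> real) \<Rightarrow> real^'n \<Rightarrow> ('n list \<Rightarrow> complex) set" where
  "J_ideal h u = fa_ideal ({fa_poly_eval (hpoly h a u) (fa_lin a) | a. True}
                            \<union> {fa_sub fa_one (fa_lin u)})"

definition qclass :: "('n list \<Rightarrow> complex) set \<Rightarrow> ('n list \<Rightarrow> complex) \<Rightarrow> ('n list \<Rightarrow> complex) set" where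
  "qclass J f = {g \<in> FA. fa_sub f g \<in> J}"

definition qcarrier :: "('n list \<Rightarrow> complex) set \<Rightarrow> ('n list \<Rightarrow> complex) set set" where
  "qcarrier J = qclass J ` FA"

definition qrep :: "('n list \<Rightarrow> complex) set \<Rightarrow> 'n list \<Rightarrow> complex" where
  "qrep X = (SOME f. f \<in> X)"

definition qadd where "qadd J X Y = qclass J (fa_add (qrep X) (qrep Y))"
definition qmult where "qmult J X Y = qclass J (fa_mult (qrep X) (qrep Y))"
definition qsmult where "qsmult J c X = qclass J (fa_smult c (qrep X))"
definition qstar where "qstar J X = qclass J (fa_star (qrep X))"
definition qone where "qone J = qclass J fa_one"

definition star_alg_iso ::
  "('n list \<Rightarrow> complex) set \<Rightarrow> ('m list \<Rightarrow> complex) set \<Rightarrow> bool" where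
  "star_alg_iso J1 J2 \<longleftrightarrow>
     (\<exists>\<Phi>. bij_betw \<Phi> (qcarrier J1) (qcarrier J2) \<and>
        (\<forall>X\<in>qcarrier J1. \<forall>Y\<in>qcarrier J1. \<Phi> (qadd J1 X Y) = qadd J2 (\<Phi> X) (\<Phi> Y)) \<and>
        (\<forall>X\<in>qcarrier J1. \<forall>Y\<in>qcarrier J1. \<Phi> (qmult J1 X Y) = qmult J2 (\<Phi> X) (\<Phi> Y)) \<and>
        (\<forall>c. \<forall>X\<in>qcarrier J1. \<Phi> (qsmult J1 c X) = qsmult J2 c (\<Phi> X)) \<and>
        (\<forall>X\<in>qcarrier J1. \<Phi> (qstar J1 X) = qstar J2 (\<Phi> X)) \<and>
        \<Phi> (qone J1) = qone J2)"

end

theory Submission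
  imports Defs "HOL-Analysis.Finite_Function_Topology"
    "HOL-Computational_Algebra.Fundamental_Theorem_Algebra"
begin

text \<open>
  In \<open>\<A>\<^sub>e(h)\<close> the element \<open>b = e' \<bullet> z\<close> is annihilated by \<open>p(t) = h(e' - t e)\<close>, all of whose roots are
  positive, so \<open>Q = b\<^bsup>-1/2\<^esup>\<close> exists as a real polynomial \<open>q(b)\<close>. The isomorphism sends \<open>z\<^sub>i\<close> to \<open>Q z\<^sub>i Q\<close>.

  That this respects the relations rests on a Cayley--Hamilton type argument. Write \<open>X = a \<bullet> z\<close> and let
  \<open>F(s, t) = h(a - s e' - t e)\<close>. Since \<open>F(s, X - s b) = 0\<close> for all real \<open>s\<close>, division by \<open>t - (X - s b)\<close> at
  \<open>t = 0\<close> yields \<open>F(s, 0) = (s b - X) G(s)\<close> with \<open>G\<close> polynomial in the central variable \<open>s\<close>. Hence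
  \<open>F(s, 0) b\<^bsup>-1\<^esup> = b\<^bsup>-1\<^esup> F(s, 0) = (s - b\<^bsup>-1\<^esup> X) G(s)\<close>, and substituting \<open>b\<^bsup>-1\<^esup> X\<close> for \<open>s\<close> on the left gives
  \<open>h(a - s e') = 0\<close> at \<open>s = b\<^bsup>-1\<^esup> X\<close>, hence also at the conjugate \<open>Q X Q\<close>.

  For the inverse, \<open>b' = e \<bullet> z\<close> is invertible in \<open>\<A>\<^bsub>e'\<^esub>(h)\<close>, as \<open>h(e) \<noteq> 0\<close>, and the same argument shows that
  its inverse \<open>c\<close> is annihilated by the same \<open>p\<close>. Taking \<open>R = q(c) c\<close>, with the same \<open>q\<close>, as the square
  root of \<open>c\<close> makes \<open>z\<^sub>i \<mapsto> R z\<^sub>i R\<close> a two-sided inverse without comparing square roots.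
\<close>

section \<open>Real polynomials evaluated in an algebra\<close>

definition alg_eval :: "real poly \<Rightarrow> 'a::real_algebra_1 \<Rightarrow> 'a" where
  "alg_eval p x = (\<Sum>k\<le>degree p. coeff p k *\<^sub>R x ^ k)"

lemma alg_eval_altdef:
  assumes "degree p \<le> n"
  shows "alg_eval p x = (\<Sum>k\<le>n. coeff p k *\<^sub>R x ^ k)"
  unfolding alg_eval_def using assms
  by (intro sum.mono_neutral_left) (auto simp: coeff_eq_0)

lemma alg_eval_0 [simp]: "alg_eval 0 x = 0"
  by (simp add: alg_eval_def)

lemma alg_eval_pCons [simp]: "alg_eval (pCons a p) x = a *\<^sub>R 1 + x * alg_eval p x"
proof -
  have "alg_eval (pCons a p) x = (\<Sum>k\<le>Suc (degree p). coeff (pCons a p) k *\<^sub>R x ^ k)"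
    by (rule alg_eval_altdef) (simp add: degree_pCons_le)
  also have "\<dots> = a *\<^sub>R 1 + x * alg_eval p x"
    unfolding sum.atMost_Suc_shift by (simp add: alg_eval_def sum_distrib_left)
  finally show ?thesis .
qed

lemma alg_eval_1 [simp]: "alg_eval 1 x = 1"
  by (simp add: one_pCons)

lemma alg_eval_add [simp]: "alg_eval (p + q) x = alg_eval p x + alg_eval q x"
  by (induction p q rule: poly_induct2) (simp_all add: algebra_simps)

lemma alg_eval_smult [simp]: "alg_eval (smult c p) x = c *\<^sub>R alg_eval p x"
  by (induction p) (simp_all add: algebra_simps)

lemma alg_eval_diff [simp]: "alg_eval (p - q) x = alg_eval p x - alg_eval q x"
  using alg_eval_add[of "p - q" q x] by simp

lemma alg_eval_mult [simp]: "alg_eval (p * q) x = alg_eval p x * alg_eval q x"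
  by (induction p) (simp_all add: algebra_simps)

text \<open>Conjugation without an inverse of \<open>w\<close>; below it moves a relation from
  \<open>w * w * x\<close> to \<open>w * x * w\<close>.\<close>

lemma alg_eval_intertwine:
  assumes "x * w = w * y"
  shows "alg_eval p x * w = w * alg_eval p y"
proof (induction p)
  case (pCons a p)
  have "x * alg_eval p x * w = w * (y * alg_eval p y)"
    by (metis assms mult.assoc pCons.IH)
  then show ?case by (simp add: algebra_simps)
qed simp

lemma alg_eval_commute_left: "x * y = y * x \<Longrightarrow> alg_eval p x * y = y * alg_eval p x"
  by (rule alg_eval_intertwine)

lemma alg_eval_commute: "alg_eval p x * x = x * alg_eval p x"
  by (rule alg_eval_commute_left) simp

lemma poly_map_poly_of_real: "poly (map_poly complex_of_real p) z = alg_eval p z"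
  by (induction p) (simp_all add: map_poly_pCons of_real_def)

lemma alg_eval_of_real: "alg_eval p (of_real x) = of_real (poly p x)"
  by (induction p) (simp_all add: scaleR_conv_of_real)

section \<open>Left substitution into polynomials with noncommuting coefficients\<close>

text \<open>\<open>left_value w K v\<close>: the function \<open>K\<close> is a polynomial with coefficients in the algebra, and \<open>v\<close> arises
  by substituting \<open>w\<close> for its variable to the left of the coefficients.\<close>

definition left_value :: "'a::real_algebra_1 \<Rightarrow> (real \<Rightarrow> 'a) \<Rightarrow> 'a \<Rightarrow> bool" where
  "left_value w K v \<longleftrightarrow>
     (\<exists>N g. (\<forall>s. K s = (\<Sum>j<N. s ^ j *\<^sub>R g j)) \<and> v = (\<Sum>j<N. w ^ j * g j))"

lemma left_valueI:
  "\<lbrakk>\<And>s. K s = (\<Sum>j<N. s ^ j *\<^sub>R g j); v = (\<Sum>j<N. w ^ j * g j)\<rbrakk> \<Longrightarrow> left_value w K v"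
  unfolding left_value_def by blast

lemma left_valueE:
  assumes "left_value w K v"
  obtains g N where "\<forall>s. K s = (\<Sum>j<N. s ^ j *\<^sub>R g j)" "v = (\<Sum>j<N. w ^ j * g j)"
  using assms unfolding left_value_def by blast

lemma left_value_const: "left_value w (\<lambda>s. c) c"
  by (rule left_valueI[where N = 1 and g = "\<lambda>_. c"]) simp_all

lemma left_value_add:
  assumes "left_value w K v" "left_value w K' v'"
  shows "left_value w (\<lambda>s. K s + K' s) (v + v')"
proof -
  obtain g N where K: "\<forall>s. K s = (\<Sum>j<N. s ^ j *\<^sub>R g j)" "v = (\<Sum>j<N. w ^ j * g j)"
    using assms(1) by (rule left_valueE)
  obtain g' N' where K': "\<forall>s. K' s = (\<Sum>j<N'. s ^ j *\<^sub>R g' j)" "v' = (\<Sum>j<N'. w ^ j * g' j)"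
    using assms(2) by (rule left_valueE)
  define M where "M = max N N'"
  \<comment> \<open>Zero padding brings both coefficient families to the common length
    \<open>M\<close>.\<close>
  define pad where "pad n f j = (if j < n then f j else 0)" for n j and f :: "nat \<Rightarrow> 'a"
  have pad: "(\<Sum>j<n. s ^ j *\<^sub>R f j) = (\<Sum>j<M. s ^ j *\<^sub>R pad n f j)"
            "(\<Sum>j<n. w ^ j * f j) = (\<Sum>j<M. w ^ j * pad n f j)"
    if "n \<le> M" for n s and f :: "nat \<Rightarrow> 'a"
    using that by (auto intro!: sum.mono_neutral_cong_left simp: pad_def split: if_splits)
  have "N \<le> M" "N' \<le> M" by (auto simp: M_def)
  show ?thesis
    by (rule left_valueI[where N = M and g = "\<lambda>j. pad N g j + pad N' g' j"])
       (simp_all add: K K' pad[OF \<open>N \<le> M\<close>] pad[OF \<open>N' \<le> M\<close>] sum.distrib algebra_simps)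
qed

lemma left_value_shift:
  assumes "left_value w K v"
  shows "left_value w (\<lambda>s. s *\<^sub>R K s) (w * v)"
proof -
  obtain g N where K: "\<forall>s. K s = (\<Sum>j<N. s ^ j *\<^sub>R g j)" "v = (\<Sum>j<N. w ^ j * g j)"
    using assms by (rule left_valueE)
  show ?thesis
    by (rule left_valueI[where N = "Suc N" and g = "\<lambda>j. case j of 0 \<Rightarrow> 0 | Suc i \<Rightarrow> g i"])
       (simp_all only: K sum.lessThan_Suc_shift, simp_all add: scaleR_sum_right sum_distrib_left mult.assoc)
qed

lemma left_value_mult_right:
  assumes "left_value w K v"
  shows "left_value w (\<lambda>s. K s * c) (v * c)"
proof -
  obtain g N where K: "\<forall>s. K s = (\<Sum>j<N. s ^ j *\<^sub>R g j)" "v = (\<Sum>j<N. w ^ j * g j)"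
    using assms by (rule left_valueE)
  show ?thesis
    by (rule left_valueI[where N = N and g = "\<lambda>j. g j * c"]) (simp_all add: K sum_distrib_right mult.assoc)
qed

text \<open>The value is the sum of the \<open>w ^ j * (c * g j)\<close>. It may differ from
  \<open>c * v\<close> when \<open>c\<close> does not commute with \<open>w\<close>, so only
  existence is claimed.\<close>

lemma left_value_mult_left:
  assumes "left_value w K v"
  shows "\<exists>v'. left_value w (\<lambda>s. c * K s) v'"
proof -
  obtain g N where K: "\<forall>s. K s = (\<Sum>j<N. s ^ j *\<^sub>R g j)" "v = (\<Sum>j<N. w ^ j * g j)"
    using assms by (rule left_valueE)
  have "left_value w (\<lambda>s. c * K s) (\<Sum>j<N. w ^ j * (c * g j))"
    by (rule left_valueI[where N = N and g = "\<lambda>j. c * g j"]) (simp_all add: K sum_distrib_left)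
  then show ?thesis ..
qed

text \<open>Unlike a general left factor, \<open>w\<close> commutes with its own powers.\<close>

lemma left_value_mult_self:
  assumes "left_value w K v"
  shows "left_value w (\<lambda>s. w * K s) (w * v)"
proof -
  obtain g N where K: "\<forall>s. K s = (\<Sum>j<N. s ^ j *\<^sub>R g j)" "v = (\<Sum>j<N. w ^ j * g j)"
    using assms by (rule left_valueE)
  have "w * (w ^ j * g j) = w ^ j * (w * g j)" for j
    by (metis mult.assoc power_commutes)
  then show ?thesis
    by (intro left_valueI[where N = N and g = "\<lambda>j. w * g j"]) (simp_all add: K sum_distrib_left)
qed

text \<open>Remainder theorem for left substitution: \<open>w * K s\<close> and
  \<open>s *\<^sub>R K s\<close> both have the value \<open>w * v\<close>.\<close>

lemma left_value_root:
  assumes "left_value w K v"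
  shows "left_value w (\<lambda>s. (w - s *\<^sub>R 1) * K s) 0"
proof -
  have "left_value w (\<lambda>s. w * K s + (s *\<^sub>R K s) * (- 1)) (w * v + (w * v) * (- 1))"
    by (intro left_value_add left_value_mult_self left_value_mult_right left_value_shift assms)
  then show ?thesis by (simp add: algebra_simps)
qed

lemma left_value_poly: "left_value w (\<lambda>s. poly p s *\<^sub>R c) (alg_eval p w * c)"
proof (induction p)
  case 0
  show ?case using left_value_const[of w 0] by simp
next
  case (pCons a p)
  have "left_value w (\<lambda>s. a *\<^sub>R c + s *\<^sub>R (poly p s *\<^sub>R c)) (a *\<^sub>R c + w * (alg_eval p w * c))"
    by (intro left_value_add left_value_const left_value_shift pCons)
  then show ?case by (simp add: algebra_simps)
qed

text \<open>Horner's scheme in \<open>P\<close>, multiplying by the pencil on the left at each step.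
  Existence of a value suffices, because \<open>left_value_root\<close> will annihilate it.\<close>

lemma left_value_alg_eval_pencil:
  "\<exists>v. left_value w (\<lambda>s. alg_eval (map_poly (\<lambda>c. poly c s) P) (x - s *\<^sub>R y)) v"
proof (induction P)
  case 0
  then show ?case using left_value_const[of w 0] by auto
next
  case (pCons c P)
  define G where "G s = alg_eval (map_poly (\<lambda>c. poly c s) P) (x - s *\<^sub>R y)" for s
  obtain v where v: "left_value w G v"
    using pCons unfolding G_def by blast
  obtain v1 where v1: "left_value w (\<lambda>s. x * G s) v1"
    using left_value_mult_left[OF v] by blast
  obtain v2 where v2: "left_value w (\<lambda>s. (- y) * G s) v2"
    using left_value_mult_left[OF v] by blast
  have "left_value w (\<lambda>s. poly c s *\<^sub>R 1 + (x * G s + s *\<^sub>R ((- y) * G s)))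
      (alg_eval c w * 1 + (v1 + w * v2))"
    by (intro left_value_add left_value_shift left_value_poly v1 v2)
  also have "(\<lambda>s. poly c s *\<^sub>R 1 + (x * G s + s *\<^sub>R ((- y) * G s))) =
     (\<lambda>s. alg_eval (map_poly (\<lambda>c. poly c s) (pCons c P)) (x - s *\<^sub>R y))"
    by (simp add: map_poly_pCons G_def algebra_simps fun_eq_iff)
  finally show ?case by blast
qed

section \<open>Restrictions of \<open>h\<close> to lines and planes\<close>

lemma homogeneous_polynomial_plane:
  assumes "homogeneous_polynomial h"
  obtains P :: "real poly poly"
  where "\<forall>s t. h (a - s *\<^sub>R u - t *\<^sub>R v) = poly (poly P [:t:]) s"
proof -
  obtain S c where h: "\<forall>x. h x = (\<Sum>\<alpha>\<in>S. c \<alpha> * (\<Prod>i\<in>UNIV. (x $ i) ^ \<alpha> i))"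
    using assms unfolding homogeneous_polynomial_def by (elim exE conjE) (rule that)
  \<comment> \<open>The outer variable is \<open>t\<close>; the coefficients are polynomials in
    \<open>s\<close>.\<close>
  define L where "L i = [:[:a $ i, - (u $ i):], [:- (v $ i):]:]" for i
  define P where "P = (\<Sum>\<alpha>\<in>S. [:[:c \<alpha>:]:] * (\<Prod>i\<in>UNIV. L i ^ \<alpha> i))"
  have "(a - s *\<^sub>R u - t *\<^sub>R v) $ i = poly (poly (L i) [:t:]) s" for i s t
    by (simp add: L_def algebra_simps)
  then show ?thesis
    by (intro that[of P]) (simp add: h P_def poly_sum poly_prod del: vector_minus_component)
qed

lemma poly_poly_eq_map_poly: "poly (poly P [:t:]) s = poly (map_poly (\<lambda>c. poly c s) P) t"
  by (induction P) (simp_all add: map_poly_pCons)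

lemma hpoly_eqI:
  assumes "\<And>t. poly p t = h (a - t *\<^sub>R u)"
  shows "hpoly h a u = p"
  unfolding hpoly_def
proof (rule the_equality)
  fix q assume "\<forall>t. poly q t = h (a - t *\<^sub>R u)"
  then have "poly q = poly p" using assms by auto
  then show "q = p" by (simp add: poly_eq_poly_eq_iff)
qed (use assms in blast)

text \<open>Two specialisations of F(s, t) = h(a - s u - t v): fixing \<open>s\<close> gives the
  polynomial of a - s u in direction \<open>v\<close>, and t = 0 gives that of \<open>a\<close> in
  direction \<open>u\<close>.\<close>

lemma hpoly_plane:
  assumes "homogeneous_polynomial h"
  obtains P :: "real poly poly"
  where "\<forall>s. hpoly h (a - s *\<^sub>R u) v = map_poly (\<lambda>c. poly c s) P" "hpoly h a u = coeff P 0"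
proof -
  obtain P where P: "\<forall>s t. h (a - s *\<^sub>R u - t *\<^sub>R v) = poly (poly P [:t:]) s"
    using assms by (rule homogeneous_polynomial_plane[where a = a and u = u and v = v])
  show ?thesis
  proof (rule that)
    show "\<forall>s. hpoly h (a - s *\<^sub>R u) v = map_poly (\<lambda>c. poly c s) P"
      by (auto intro!: hpoly_eqI simp: P simp flip: poly_poly_eq_map_poly)
    show "hpoly h a u = coeff P 0"
      by (rule hpoly_eqI) (use P[rule_format, of _ 0] in \<open>simp add: poly_0_coeff_0\<close>)
  qed
qed

lemma poly_hpoly:
  assumes "homogeneous_polynomial h"
  shows "poly (hpoly h a u) t = h (a - t *\<^sub>R u)"
proof -
  obtain P where P: "\<forall>s t. h (a - s *\<^sub>R u - t *\<^sub>R u) = poly (poly P [:t:]) s"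
    using assms by (rule homogeneous_polynomial_plane[where a = a and u = u and v = u])
  have "poly (coeff P 0) t = h (a - t *\<^sub>R u)" for t
    using P[rule_format, of t 0] by (simp add: poly_0_coeff_0)
  then have "hpoly h a u = coeff P 0"
    by (intro hpoly_eqI)
  then show ?thesis using P[rule_format, of t 0] by (simp add: poly_0_coeff_0)
qed

section \<open>Inverse square roots modulo a polynomial with positive roots\<close>

text \<open>The square root is lifted from \<open>p\<close> to \<open>p * (t - x)\<close> by correcting \<open>q\<close> with a multiple of \<open>p\<close>:
  a Newton step if \<open>x\<close> is already a root of \<open>p\<close>, and interpolation otherwise.\<close>
lemma inverse_sqrt_modulo_step:
  fixes x :: real
  assumes "p dvd q ^ 2 * [:0, 1:] - 1" "x > 0"
  obtains q' where "[:- x, 1:] * p dvd q' ^ 2 * [:0, 1:] - 1"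
proof -
  obtain s where s: "q ^ 2 * [:0, 1:] - 1 = p * s"
    using assms(1) by (rule dvdE)
  have sx: "poly q x ^ 2 * x - 1 = poly p x * poly s x"
    using arg_cong[OF s, of "\<lambda>r. poly r x"] by (simp add: mult.commute)
  \<comment> \<open>\<open>r c\<close> is the cofactor of \<open>p\<close> after \<open>q\<close> is
    replaced by \<open>q + [:c:] * p\<close>; a zero of \<open>r c\<close> at \<open>x\<close>
    provides the new linear factor.\<close>
  define r where "r c = s + [:2 * c:] * q * [:0, 1:] + [:c\<^sup>2:] * p * [:0, 1:]" for c
  have r: "(q + [:c:] * p) ^ 2 * [:0, 1:] - 1 = p * r c" for c
  proof -
    have cc: "[:c\<^sup>2:] = [:c:] * [:c:]" "[:2 * c:] = 2 * [:c:]"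
      by (simp_all add: power2_eq_square numeral_poly)
    have "(q + [:c:] * p) ^ 2 * [:0, 1:] - 1 = (q ^ 2 * [:0, 1:] - 1)
        + p * (2 * [:c:] * q * [:0, 1:] + [:c:] * [:c:] * p * [:0, 1:])"
      by (simp only: power2_eq_square) (simp only: algebra_simps mult_2 mult_2_right)
    then show ?thesis unfolding s r_def cc by (simp only: algebra_simps)
  qed
  have "\<exists>c. poly (r c) x = 0"
  proof (cases "poly p x = 0")
    case True
    \<comment> \<open>At \<open>x\<close>, \<open>r c\<close> is now affine in \<open>c\<close> with
      slope 2 q(x) x, nonzero because q(x)^2 x = 1.\<close>
    with sx have "poly q x \<noteq> 0" by auto
    then have "poly (r (- poly s x / (2 * poly q x * x))) x = 0"
      using assms(2) True by (simp add: r_def)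
    then show ?thesis ..
  next
    case False
    \<comment> \<open>This choice gives the corrected polynomial the value \<open>1 / sqrt x\<close>
      at \<open>x\<close>.\<close>
    define c where "c = (1 / sqrt x - poly q x) / poly p x"
    have "poly q x + c * poly p x = 1 / sqrt x"
      using False by (simp add: c_def)
    then have "poly p x * poly (r c) x = 0"
      using arg_cong[OF r[of c], of "\<lambda>r. poly r x"] assms(2)
      by (simp add: power_divide)
    with False show ?thesis by auto
  qed
  then obtain c where "[:- x, 1:] dvd r c" by (auto simp: poly_eq_0_iff_dvd)
  then have "p * [:- x, 1:] dvd p * r c" by (rule mult_dvd_mono[OF dvd_refl])
  then have "[:- x, 1:] * p dvd (q + [:c:] * p) ^ 2 * [:0, 1:] - 1"
    unfolding r by (simp only: mult.commute)
  then show ?thesis by (rule that)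
qed

text \<open>Induction on the degree: every complex root is real and positive, and the quotient by
  its linear factor inherits the hypothesis.\<close>

lemma inverse_sqrt_modulo:
  assumes "only_positive_roots p"
  obtains q where "p dvd q ^ 2 * [:0, 1:] - 1"
proof -
  have "\<exists>q. p dvd q ^ 2 * [:0, 1:] - 1"
    using assms
  proof (induction "degree p" arbitrary: p)
    case 0
    then obtain c where c: "p = [:c:]" by (metis degree_eq_zeroE)
    \<comment> \<open>The zero polynomial also has degree 0; it is excluded because -1 would be a
      root.\<close>
    have "c \<noteq> 0"
    proof
      assume "c = 0"
      with 0(2) c have "(0::real) < Re (- 1)"
        unfolding only_positive_roots_def by (metis map_poly_0 pCons_0_0 poly_0)
      then show False by simp
    qed
    with c have "is_unit p" by (simp add: is_unit_const_poly_iff dvd_field_iff)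
    then show ?case using unit_imp_dvd by blast
  next
    case (Suc n)
    let ?c = "map_poly complex_of_real"
    have "\<not> constant (poly (?c p))"
      using Suc(2) by (simp add: constant_degree degree_map_poly)
    then obtain z where z: "poly (?c p) z = 0"
      using fundamental_theorem_of_algebra by blast
    with Suc(3) have "z \<in> \<real>" and pos: "Re z > 0"
      by (auto simp: only_positive_roots_def)
    then have zx: "z = complex_of_real (Re z)" by (simp add: complex_is_Real_iff complex_eq_iff)
    define x where "x = Re z"
    have "complex_of_real (poly p x) = 0"
      using z zx by (metis poly_map_poly_of_real alg_eval_of_real x_def)
    then have "[:- x, 1:] dvd p" by (simp add: poly_eq_0_iff_dvd)
    then obtain p' where p': "p = [:- x, 1:] * p'" by (rule dvdE)
    have "p \<noteq> 0" using Suc(2) by auto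
    then have "n = degree p'"
      using Suc(2) p' by (auto simp: degree_mult_eq simp del: mult_pCons_left)
    moreover have "only_positive_roots p'"
      using Suc(3) by (simp add: only_positive_roots_def p' poly_map_poly_of_real del: mult_pCons_left)
    ultimately obtain q where "p' dvd q ^ 2 * [:0, 1:] - 1"
      using Suc(1) by blast
    then show ?case
      using inverse_sqrt_modulo_step[of p' q x] pos unfolding p' x_def by metis
  qed
  then show ?thesis using that by blast
qed

section \<open>Two-sided ideals\<close>

locale algebra_ideal =
  fixes I :: "'a::real_algebra_1 set"
  assumes zero_mem: "0 \<in> I"
    and add_mem: "a \<in> I \<Longrightarrow> b \<in> I \<Longrightarrow> a + b \<in> I"
    and mult_left_mem: "a \<in> I \<Longrightarrow> c * a \<in> I"
    and mult_right_mem: "a \<in> I \<Longrightarrow> a * c \<in> I"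
begin

lemma scaleR_mem: "a \<in> I \<Longrightarrow> r *\<^sub>R a \<in> I"
  using mult_left_mem[of a "r *\<^sub>R 1"] by simp

lemma uminus_mem: "a \<in> I \<Longrightarrow> - a \<in> I"
  using scaleR_mem[of a "- 1"] by simp

lemma diff_mem: "a \<in> I \<Longrightarrow> b \<in> I \<Longrightarrow> a - b \<in> I"
  using add_mem[of a "- b"] uminus_mem[of b] by simp

lemma sum_mem: "(\<And>i. i \<in> S \<Longrightarrow> f i \<in> I) \<Longrightarrow> sum f S \<in> I"
  by (induction S rule: infinite_finite_induct) (auto simp: zero_mem intro: add_mem)

text \<open>Congruences stand for equations in the quotient, so that computations stay with
  representatives.\<close>

definition eqv (infix "\<doteq>" 50) where "a \<doteq> b \<longleftrightarrow> a - b \<in> I"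

lemma eqv_refl [simp, intro]: "a \<doteq> a"
  by (simp add: eqv_def zero_mem)

lemma eqv_sym: "a \<doteq> b \<Longrightarrow> b \<doteq> a"
  unfolding eqv_def using uminus_mem[of "a - b"] by simp

lemma eqv_trans [trans]: "a \<doteq> b \<Longrightarrow> b \<doteq> c \<Longrightarrow> a \<doteq> c"
  unfolding eqv_def using add_mem[of "a - b" "b - c"] by simp

lemma eqv_0_iff: "a \<doteq> 0 \<longleftrightarrow> a \<in> I"
  by (simp add: eqv_def)

lemma eqv_add: "a \<doteq> b \<Longrightarrow> c \<doteq> d \<Longrightarrow> a + c \<doteq> b + d"
  unfolding eqv_def using add_mem[of "a - b" "c - d"] by (simp add: algebra_simps)

lemma eqv_mult: "a \<doteq> b \<Longrightarrow> c \<doteq> d \<Longrightarrow> a * c \<doteq> b * d"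
  unfolding eqv_def
  using add_mem[OF mult_right_mem[of "a - b" c] mult_left_mem[of "c - d" b]]
  by (simp add: algebra_simps)

lemma eqv_prod_list:
  assumes "\<And>i. f i \<doteq> g i"
  shows "prod_list (map f w) \<doteq> prod_list (map g w)"
  by (induction w) (auto intro!: eqv_mult assms)

lemma eqv_alg_eval: "a \<doteq> b \<Longrightarrow> alg_eval p a \<doteq> alg_eval p b"
  by (induction p) (auto intro!: eqv_add eqv_mult)

lemma eqv_alg_eval_dvd: "p dvd q \<Longrightarrow> alg_eval p a \<doteq> 0 \<Longrightarrow> alg_eval q a \<doteq> 0"
  by (auto simp: eqv_0_iff mult_right_mem elim!: dvdE)

lemma eqv_inverse_unique:
  assumes "a * b \<doteq> 1" "b * c \<doteq> 1"
  shows "a \<doteq> c"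
proof -
  have "a = a * 1" by simp
  also have "\<dots> \<doteq> a * (b * c)" by (intro eqv_mult eqv_sym[OF assms(2)]) simp
  also have "\<dots> = (a * b) * c" by (simp add: mult.assoc)
  also have "\<dots> \<doteq> 1 * c" by (intro eqv_mult assms) simp
  finally show ?thesis by simp
qed

text \<open>Induction on the degree \<open>n\<close>: replacing the polynomial \<open>P\<close> by \<open>P(2 s) - 2\<^sup>n P(s)\<close> removes its top coefficient.\<close>
lemma coefficients_mem:
  assumes "\<And>s::real. (\<Sum>j<n. s ^ j *\<^sub>R g j) \<in> I" "j < n"
  shows "g j \<in> I"
  using assms
proof (induction n arbitrary: g j)
  case (Suc n)
  have low: "g i \<in> I" if "i < n" for i
  proof -
    have "(\<Sum>j<n. s ^ j *\<^sub>R ((2 ^ j - 2 ^ n) *\<^sub>R g j)) \<in> I" for s :: real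
    proof -
      have "(\<Sum>j<Suc n. (2 * s) ^ j *\<^sub>R g j) - 2 ^ n *\<^sub>R (\<Sum>j<Suc n. s ^ j *\<^sub>R g j) \<in> I"
        by (intro diff_mem scaleR_mem Suc.prems)
      also have "(\<Sum>j<Suc n. (2 * s) ^ j *\<^sub>R g j) - 2 ^ n *\<^sub>R (\<Sum>j<Suc n. s ^ j *\<^sub>R g j)
          = (\<Sum>j<Suc n. (2 * s) ^ j *\<^sub>R g j - 2 ^ n *\<^sub>R (s ^ j *\<^sub>R g j))"
        by (simp only: scaleR_sum_right sum_subtractf)
      also have "\<dots> = (\<Sum>j<n. s ^ j *\<^sub>R ((2 ^ j - 2 ^ n) *\<^sub>R g j))"
        by (simp add: power_mult_distrib algebra_simps)
      finally show ?thesis .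
    qed
    from Suc.IH[OF this that] have "(1 / (2 ^ i - 2 ^ n)) *\<^sub>R ((2 ^ i - 2 ^ n) *\<^sub>R g i) \<in> I"
      by (rule scaleR_mem)
    moreover have "(2::real) ^ i - 2 ^ n \<noteq> 0" using that by simp
    ultimately show ?thesis by simp
  qed
  have "(\<Sum>j<Suc n. 1 ^ j *\<^sub>R g j) - (\<Sum>j<n. g j) \<in> I"
    by (intro diff_mem Suc.prems sum_mem low) simp
  then have "g n \<in> I" by simp
  with low Suc.prems(2) show ?case by (auto simp: less_Suc_eq)
qed simp

text \<open>By \<open>coefficients_mem\<close> all coefficients of \<open>K\<close> lie in
  \<open>I\<close>, and substitution only forms sums of left multiples of them.\<close>

lemma left_value_mem:
  assumes "left_value w K v" "\<And>s. K s \<in> I"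
  shows "v \<in> I"
proof -
  obtain g N where K: "\<forall>s. K s = (\<Sum>j<N. s ^ j *\<^sub>R g j)" "v = (\<Sum>j<N. w ^ j * g j)"
    using assms(1) by (rule left_valueE)
  have "g j \<in> I" if "j < N" for j
    using coefficients_mem[where n = N and g = g and j = j] assms(2) that by (simp add: K)
  then show ?thesis unfolding K by (intro sum_mem mult_left_mem) simp
qed

text \<open>The Cayley--Hamilton argument, for a left inverse \<open>z\<close> of \<open>y\<close>
  modulo \<open>I\<close>.\<close>

lemma alg_eval_pencil_inverse:
  assumes pencil: "\<And>s. alg_eval (map_poly (\<lambda>c. poly c s) P) (x - s *\<^sub>R y) \<doteq> 0"
    and inv: "z * y \<doteq> 1"
  shows "alg_eval (coeff P 0) (z * x) \<doteq> 0"
proof (cases P)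
  \<comment> \<open>This splits F(s, t) = f(s) + t P'(s, t): \<open>f\<close> is F(s, 0), and
    \<open>P'\<close> supplies the cofactor G(s).\<close>
  case (pCons f P')
  define w where "w = z * x"
  define G where "G s = alg_eval (map_poly (\<lambda>c. poly c s) P') (x - s *\<^sub>R y)" for s
  obtain v where v: "left_value w G v"
    unfolding G_def using left_value_alg_eval_pencil by blast
  \<comment> \<open>Substituting \<open>w\<close> for \<open>s\<close> kills the second summand and
    leaves \<open>alg_eval f w * z\<close>.\<close>
  have "left_value w (\<lambda>s. poly f s *\<^sub>R z + (w - s *\<^sub>R 1) * G s) (alg_eval f w * z + 0)"
    by (intro left_value_add left_value_poly left_value_root[OF v])
  moreover have "poly f s *\<^sub>R z + (w - s *\<^sub>R 1) * G s \<in> I" for s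
  proof -
    have "poly f s *\<^sub>R 1 + (x - s *\<^sub>R y) * G s \<in> I"
      using pencil[of s] by (simp add: pCons map_poly_pCons eqv_0_iff G_def)
    then have "z * (poly f s *\<^sub>R 1 + (x - s *\<^sub>R y) * G s) \<in> I"
      by (rule mult_left_mem)
    moreover have "s *\<^sub>R ((z * y - 1) * G s) \<in> I"
      using inv by (intro scaleR_mem mult_right_mem) (simp add: eqv_def)
    ultimately have "z * (poly f s *\<^sub>R 1 + (x - s *\<^sub>R y) * G s) + s *\<^sub>R ((z * y - 1) * G s) \<in> I"
      by (rule add_mem)
    then show ?thesis by (simp add: w_def algebra_simps)
  qed
  ultimately have "alg_eval f w * z + 0 \<in> I" by (rule left_value_mem)
  \<comment> \<open>The factor \<open>z\<close> is cancelled by multiplying with \<open>y\<close> on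
    the right.\<close>
  then have "alg_eval f w * z * y \<doteq> 0" by (simp add: eqv_0_iff mult_right_mem)
  moreover have "alg_eval f w * (z * y) \<doteq> alg_eval f w * 1"
    by (intro eqv_mult inv) simp
  ultimately have "alg_eval f w \<doteq> 0"
    by (metis eqv_sym eqv_trans mult.assoc mult.right_neutral)
  then show ?thesis by (simp add: pCons w_def)
qed

lemma eqv_unit_cancel_left:
  assumes "b * a \<doteq> 1" "a * x \<doteq> 0"
  shows "x \<doteq> 0"
proof -
  have "x = 1 * x" by simp
  also have "\<dots> \<doteq> (b * a) * x" by (intro eqv_mult eqv_sym[OF assms(1)]) simp
  also have "\<dots> = b * (a * x)" by (simp add: mult.assoc)
  also have "\<dots> \<doteq> b * 0" by (intro eqv_mult assms(2)) simp
  finally show ?thesis by simp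
qed

lemma eqv_sandwich_cancel:
  assumes "a * b \<doteq> 1" "c * d \<doteq> 1"
  shows "a * (b * x * c) * d \<doteq> x"
proof -
  have "a * (b * x * c) * d = (a * b) * x * (c * d)" by (simp add: mult.assoc)
  also have "\<dots> \<doteq> 1 * x * 1" by (intro eqv_mult assms eqv_refl)
  finally show ?thesis by simp
qed

lemma inverse_sqrt_eqv:
  assumes "p dvd q ^ 2 * [:0, 1:] - 1" "alg_eval p b \<doteq> 0"
  shows "alg_eval q b * alg_eval q b * b \<doteq> 1"
  using eqv_alg_eval_dvd[OF assms] by (simp add: power2_eq_square eqv_def del: mult_pCons_right)

text \<open>Writing p = a + t p', the element b p'(b) is congruent to -a. The inverse is thus a
  polynomial in \<open>b\<close> and commutes with \<open>b\<close>.\<close>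

lemma alg_eval_root_inverse:
  assumes "poly p 0 \<noteq> 0" "alg_eval p b \<doteq> 0"
  obtains r where "alg_eval r b * b \<doteq> 1"
proof (cases p)
  case (pCons a p')
  then have "a \<noteq> 0" using assms(1) by simp
  define k where "k = - 1 / a"
  have "k * a = - 1" using \<open>a \<noteq> 0\<close> by (simp add: k_def)
  then have "alg_eval (smult k p') b * b - 1 = k *\<^sub>R alg_eval p b"
    by (simp add: pCons alg_eval_commute scaleR_add_right)
  moreover have "k *\<^sub>R alg_eval p b \<in> I"
    using assms(2) unfolding eqv_0_iff by (rule scaleR_mem)
  ultimately have "alg_eval (smult k p') b * b \<doteq> 1"
    by (simp only: eqv_def)
  then show ?thesis by (rule that)
qed

text \<open>By linearity, \<open>z (a - s *\<^sub>R u)\<close> is a pencil in \<open>s\<close>, so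
  \<open>alg_eval_pencil_inverse\<close> exchanges direction \<open>v\<close> for
  \<open>u\<close>.\<close>

lemma hpoly_eqv_inverse:
  fixes z :: "real^'n::finite \<Rightarrow> 'a"
  assumes "homogeneous_polynomial h" "linear z"
    and "\<And>a. alg_eval (hpoly h a v) (z a) \<doteq> 0"
    and "y * z u \<doteq> 1"
  shows "alg_eval (hpoly h a u) (y * z a) \<doteq> 0"
proof -
  obtain P where P: "\<forall>s. hpoly h (a - s *\<^sub>R u) v = map_poly (\<lambda>c. poly c s) P" "hpoly h a u = coeff P 0"
    using assms(1) by (rule hpoly_plane)
  have "alg_eval (map_poly (\<lambda>c. poly c s) P) (z a - s *\<^sub>R z u) \<doteq> 0" for s
    using assms(3)[of "a - s *\<^sub>R u"] P(1) assms(2) by (simp add: linear_diff linear_scale)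
  from alg_eval_pencil_inverse[OF this assms(4)] show ?thesis unfolding P(2) .
qed

text \<open>The case \<open>y = w * w\<close> gives the relation for \<open>w * w * z a\<close>;
  intertwining with \<open>w\<close> and cancelling it yields the symmetric form suited to the
  involution.\<close>

lemma hpoly_eqv_sandwich:
  fixes z :: "real^'n::finite \<Rightarrow> 'a"
  assumes "homogeneous_polynomial h" "linear z"
    and "\<And>a. alg_eval (hpoly h a v) (z a) \<doteq> 0"
    and w: "w * w * z u \<doteq> 1" "w * z u = z u * w"
  shows "alg_eval (hpoly h a u) (w * z a * w) \<doteq> 0"
proof -
  let ?E = "\<lambda>x. alg_eval (hpoly h a u) x"
  have "?E (w * w * z a) * w \<doteq> 0"
    using hpoly_eqv_inverse[OF assms(1-3) w(1)] by (simp add: eqv_0_iff mult_right_mem)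
  also have "?E (w * w * z a) * w = w * ?E (w * z a * w)"
    by (rule alg_eval_intertwine) (simp add: mult.assoc)
  finally have "w * ?E (w * z a * w) \<doteq> 0" .
  moreover have "(z u * w) * w \<doteq> 1"
    using w by (metis mult.assoc)
  ultimately show ?thesis by (rule eqv_unit_cancel_left[rotated])
qed

end

section \<open>The free algebra\<close>

text \<open>With words as an additive monoid, the convolution product of finitely supported functions is the
  product of the free algebra.\<close>

instantiation list :: (type) monoid_add
begin

definition "xs + ys = xs @ ys" for xs ys :: "'a list"
definition "0 = ([] :: 'a list)"

instance by standard (simp_all add: plus_list_def zero_list_def)

end

lemma poly_mapping_single_induct [case_names zero single]:
  assumes "P 0" "\<And>k c f. P f \<Longrightarrow> P (Poly_Mapping.single k c + f)"
  shows "P f"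
proof (induction f rule: Poly_Mapping.update_induct)
  case const
  show ?case by fact
next
  case (update f a b)
  have "Poly_Mapping.update a b f = Poly_Mapping.single a b + f"
    using update(1)
    by (intro poly_mapping_eqI) (auto simp: lookup_update lookup_add lookup_single when_def in_keys_iff)
  with update(3) assms(2) show ?case by metis
qed

lemma lookup_single_0_mult:
  fixes p :: "'a::monoid_add \<Rightarrow>\<^sub>0 'b::semiring_0"
  shows "Poly_Mapping.lookup (Poly_Mapping.single 0 c * p) k = c * Poly_Mapping.lookup p k"
  by (simp add: Poly_Mapping.map.rep_eq when_def flip: mult_map_scale_conv_mult)

lemma single_0_central:
  fixes p :: "'a::monoid_add \<Rightarrow>\<^sub>0 'b::semiring_0"
  assumes "\<And>b. c * b = b * c"
  shows "Poly_Mapping.single 0 c * p = p * Poly_Mapping.single 0 c"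
  by (induction p rule: poly_mapping_single_induct)
     (simp_all add: distrib_left distrib_right mult_single assms)

lemma lookup_scaleR: "Poly_Mapping.lookup (r *\<^sub>R p) k = r *\<^sub>R Poly_Mapping.lookup p k"
proof -
  have "finite {k. r *\<^sub>R Poly_Mapping.lookup p k \<noteq> 0}"
    by (rule finite_subset[OF _ finite_lookup[of p]]) auto
  then show ?thesis by (simp add: scaleR_poly_mapping_def)
qed

lemma scaleR_poly_mapping:
  fixes p :: "'a::monoid_add \<Rightarrow>\<^sub>0 'b::real_algebra_1"
  shows "r *\<^sub>R p = Poly_Mapping.single 0 (of_real r) * p"
  by (rule poly_mapping_eqI) (simp add: lookup_scaleR lookup_single_0_mult scaleR_conv_of_real)

text \<open>Real scaling is multiplication by a central element supported at the neutral
  index.\<close>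

instance poly_mapping :: (monoid_add, real_algebra_1) real_algebra_1
proof
  fix r :: real and x y :: "'a \<Rightarrow>\<^sub>0 'b"
  show "r *\<^sub>R x * y = r *\<^sub>R (x * y)"
    by (simp add: scaleR_poly_mapping mult.assoc)
  have "Poly_Mapping.single 0 (of_real r) * x = x * Poly_Mapping.single 0 (of_real r :: 'b)"
    by (rule single_0_central) (simp add: of_real_def)
  then show "x * r *\<^sub>R y = r *\<^sub>R (x * y)"
    by (simp add: scaleR_poly_mapping flip: mult.assoc)
qed

type_synonym 'n free_alg = "'n list \<Rightarrow>\<^sub>0 complex"

definition const :: "complex \<Rightarrow> 'n free_alg" where
  "const c = Poly_Mapping.single [] c"

definition var :: "'n \<Rightarrow> 'n free_alg" where
  "var i = Poly_Mapping.single [i] 1"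

lemma const_0 [simp]: "const 0 = 0" and const_1 [simp]: "const 1 = 1"
  by (simp_all add: const_def flip: zero_list_def)

lemma const_add: "const (a + b) = const a + const b"
  by (simp add: const_def single_add)

lemma const_mult: "const (a * b) = const a * const b"
  by (simp add: const_def mult_single plus_list_def)

lemma const_commute: "const c * f = f * const c"
  unfolding const_def zero_list_def[symmetric] by (rule single_0_central) simp

lemma scaleR_free_alg: "r *\<^sub>R f = const (of_real r) * f"
  for f :: "'n free_alg"
  by (simp add: scaleR_poly_mapping const_def zero_list_def)

lemma single_word: "Poly_Mapping.single w c = const c * prod_list (map var w)"
proof -
  have "prod_list (map var w) = Poly_Mapping.single w 1"
  proof (induction w)
    case Nil
    show ?case using single_one[where 'a = "'a list"] by (simp add: zero_list_def)
  next
    case (Cons i w)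
    then show ?case by (simp add: var_def mult_single plus_list_def)
  qed
  then show ?thesis by (simp add: const_def mult_single plus_list_def)
qed

section \<open>Homomorphisms of the free algebra given by images of the variables\<close>

definition subst :: "('n \<Rightarrow> 'm free_alg) \<Rightarrow> 'n free_alg \<Rightarrow> 'm free_alg" where
  "subst \<sigma> f = (\<Sum>w\<in>Poly_Mapping.keys f. const (Poly_Mapping.lookup f w) * prod_list (map \<sigma> w))"

lemma subst_0 [simp]: "subst \<sigma> 0 = 0"
  by (simp add: subst_def)

lemma subst_add: "subst \<sigma> (f + g) = subst \<sigma> f + subst \<sigma> g"
  unfolding subst_def
  by (rule setsum_keys_plus_distrib) (simp_all add: const_add distrib_right)

lemma subst_single: "subst \<sigma> (Poly_Mapping.single w c) = const c * prod_list (map \<sigma> w)"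
  by (cases "c = 0") (simp_all add: subst_def)

lemma subst_const [simp]: "subst \<sigma> (const c) = const c"
  by (simp add: const_def subst_single)

lemma subst_1 [simp]: "subst \<sigma> 1 = 1"
  using subst_const[of \<sigma> 1] by (simp del: subst_const)

lemma subst_var [simp]: "subst \<sigma> (var i) = \<sigma> i"
  by (simp add: var_def subst_single)

text \<open>Bilinearity reduces the claim to monomials, whose coefficients are central.\<close>

lemma subst_mult: "subst \<sigma> (f * g) = subst \<sigma> f * subst \<sigma> g"
proof (induction f rule: poly_mapping_single_induct)
  case (single w c f)
  have "subst \<sigma> (Poly_Mapping.single w c * g) = subst \<sigma> (Poly_Mapping.single w c) * subst \<sigma> g"
  proof (induction g rule: poly_mapping_single_induct)
    case (single v d g)
    have "const (c * d) * (prod_list (map \<sigma> w) * prod_list (map \<sigma> v)) =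
        const c * prod_list (map \<sigma> w) * (const d * prod_list (map \<sigma> v))"
      by (simp add: const_mult mult.assoc const_commute[of d "prod_list (map \<sigma> w)"]
        flip: mult.assoc[of "const d"])
    with single show ?case
      by (simp add: subst_add distrib_left mult_single subst_single plus_list_def)
  qed simp
  with single show ?case by (simp add: subst_add distrib_right)
qed simp

lemma subst_diff: "subst \<sigma> (f - g) = subst \<sigma> f - subst \<sigma> g"
  using subst_add[of \<sigma> "f - g" g] by simp

lemma subst_scaleR: "subst \<sigma> (r *\<^sub>R f) = r *\<^sub>R subst \<sigma> f"
  by (simp add: scaleR_free_alg subst_mult)

lemma subst_prod_list: "subst \<sigma> (prod_list fs) = prod_list (map (subst \<sigma>) fs)"
  by (induction fs) (simp_all add: subst_mult)

lemma subst_alg_eval: "subst \<sigma> (alg_eval p f) = alg_eval p (subst \<sigma> f)"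
  by (induction p) (simp_all add: subst_add subst_mult subst_scaleR)

lemma subst_subst: "subst \<tau> (subst \<sigma> f) = subst (\<lambda>i. subst \<tau> (\<sigma> i)) f"
  by (induction f rule: poly_mapping_single_induct)
     (simp_all add: subst_add subst_single subst_mult subst_prod_list o_def)

section \<open>The involution\<close>

definition star :: "'n free_alg \<Rightarrow> 'n free_alg" where
  "star f = Poly_Mapping.map cnj (Poly_Mapping.map_key rev f)"

lemma lookup_star: "Poly_Mapping.lookup (star f) w = cnj (Poly_Mapping.lookup f (rev w))"
  by (auto simp: star_def Poly_Mapping.map.rep_eq map_key.rep_eq when_def)

lemma star_0 [simp]: "star 0 = 0"
  by (rule poly_mapping_eqI) (simp add: lookup_star)

lemma star_add: "star (f + g) = star f + star g"
  by (rule poly_mapping_eqI) (simp add: lookup_star lookup_add)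

lemma star_diff: "star (f - g) = star f - star g"
  by (rule poly_mapping_eqI) (simp add: lookup_star lookup_minus)

lemma star_single: "star (Poly_Mapping.single w c) = Poly_Mapping.single (rev w) (cnj c)"
  by (rule poly_mapping_eqI) (auto simp: lookup_star lookup_single when_def)

lemma star_const [simp]: "star (const c) = const (cnj c)"
  by (simp add: const_def star_single)

lemma star_1 [simp]: "star 1 = 1"
  using star_const[of 1] by (simp del: star_const)

lemma star_var [simp]: "star (var i) = var i"
  by (simp add: var_def star_single)

lemma star_mult: "star (f * g) = star g * star f"
proof (induction f rule: poly_mapping_single_induct)
  case (single w c f)
  have "star (Poly_Mapping.single w c * g) = star g * star (Poly_Mapping.single w c)"
    by (induction g rule: poly_mapping_single_induct)
       (simp_all add: star_add distrib_left distrib_right mult_single star_single plus_list_def mult.commute)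
  with single show ?case by (simp add: star_add distrib_right distrib_left)
qed simp

lemma star_scaleR: "star (r *\<^sub>R f) = r *\<^sub>R star f"
  by (simp add: scaleR_free_alg star_mult) (rule const_commute[symmetric])

lemma star_alg_eval: "star (alg_eval p f) = alg_eval p (star f)"
  by (induction p) (simp_all add: star_add star_mult star_scaleR alg_eval_commute)

lemma star_subst:
  assumes "\<And>i. star (\<sigma> i) = \<sigma> i"
  shows "star (subst \<sigma> f) = subst \<sigma> (star f)"
proof (induction f rule: poly_mapping_single_induct)
  case (single w c f)
  have "star (prod_list (map \<sigma> w)) = prod_list (map \<sigma> (rev w))"
    by (induction w) (simp_all add: star_mult assms)
  with single show ?case
    by (simp add: star_add subst_add star_single subst_single star_mult const_commute[of "cnj c"])
qed simp

text \<open>Monomials are constants times words in the variables, so the variables decide. This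
  serves to recognise the two composites as identities.\<close>

lemma subst_eqv_self:
  assumes "algebra_ideal I" "\<And>i. algebra_ideal.eqv I (\<sigma> i) (var i)"
  shows "algebra_ideal.eqv I (subst \<sigma> f) f"
proof -
  interpret algebra_ideal I by fact
  show ?thesis
  proof (induction f rule: poly_mapping_single_induct)
    case (single w c f)
    have "subst \<sigma> (Poly_Mapping.single w c) \<doteq> Poly_Mapping.single w c"
      by (simp only: single_word[of w c] subst_mult subst_const subst_prod_list map_map o_def subst_var)
         (intro eqv_mult eqv_prod_list assms eqv_refl)
    with single show ?case by (auto simp: subst_add intro: eqv_add)
  qed simp
qed

section \<open>Linear forms in the variables\<close>

definition lin :: "real^'n::finite \<Rightarrow> 'n free_alg" where
  "lin a = (\<Sum>i\<in>UNIV. (a $ i) *\<^sub>R var i)"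

lemma linear_lin: "linear lin"
  by (rule linearI) (simp_all add: lin_def scaleR_add_left sum.distrib scaleR_sum_right)

lemma star_sum: "star (sum f A) = (\<Sum>i\<in>A. star (f i))"
  by (induction A rule: infinite_finite_induct) (simp_all add: star_add)

lemma subst_sum: "subst \<sigma> (sum f A) = (\<Sum>i\<in>A. subst \<sigma> (f i))"
  by (induction A rule: infinite_finite_induct) (simp_all add: subst_add)

lemma star_lin [simp]: "star (lin a) = lin a"
  by (simp add: lin_def star_sum star_scaleR)

lemma subst_lin_sandwich: "subst (\<lambda>i. q * var i * q) (lin a) = q * lin a * q"
  by (simp add: lin_def subst_sum subst_scaleR sum_distrib_left sum_distrib_right)

section \<open>Quotients of the free algebra\<close>

text \<open>This trades the function encoding for a type with ring structure; the following lemmas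
  translate each operation.\<close>

lemma range_lookup: "range (Poly_Mapping.lookup :: 'n free_alg \<Rightarrow> _) = FA"
proof
  show "range (Poly_Mapping.lookup :: 'n free_alg \<Rightarrow> _) \<subseteq> FA"
    by (auto simp: FA_def)
  show "FA \<subseteq> range (Poly_Mapping.lookup :: 'n free_alg \<Rightarrow> _)"
  proof
    fix f :: "'n list \<Rightarrow> complex"
    assume "f \<in> FA"
    then have "f = Poly_Mapping.lookup (Abs_poly_mapping f)" by (simp add: FA_def)
    then show "f \<in> range Poly_Mapping.lookup" by (rule range_eqI)
  qed
qed

lemma lookup_in_FA [simp]: "Poly_Mapping.lookup x \<in> FA"
  using range_lookup by auto

lemma fa_zero_lookup: "fa_zero = Poly_Mapping.lookup 0"
  by (simp add: fa_zero_def fun_eq_iff)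

lemma fa_one_lookup: "fa_one = Poly_Mapping.lookup 1"
  by (auto simp: fa_one_def fun_eq_iff lookup_one zero_list_def when_def)

lemma fa_var_lookup: "fa_var i = Poly_Mapping.lookup (var i)"
  by (auto simp: fa_var_def var_def fun_eq_iff lookup_single when_def)

lemma fa_add_lookup: "fa_add (Poly_Mapping.lookup f) (Poly_Mapping.lookup g) = Poly_Mapping.lookup (f + g)"
  by (simp add: fa_add_def fun_eq_iff lookup_add)

lemma fa_sub_lookup: "fa_sub (Poly_Mapping.lookup f) (Poly_Mapping.lookup g) = Poly_Mapping.lookup (f - g)"
  by (simp add: fa_sub_def fun_eq_iff lookup_minus)

lemma fa_smult_lookup: "fa_smult c (Poly_Mapping.lookup f) = Poly_Mapping.lookup (const c * f)"
  unfolding const_def zero_list_def[symmetric] fa_smult_def by (simp add: lookup_single_0_mult fun_eq_iff)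

lemma fa_star_lookup: "fa_star (Poly_Mapping.lookup f) = Poly_Mapping.lookup (star f)"
  by (simp add: fa_star_def fun_eq_iff lookup_star)

lemma fa_mult_lookup:
  "fa_mult (Poly_Mapping.lookup f) (Poly_Mapping.lookup g) = Poly_Mapping.lookup (f * g)"
proof
  fix w
  show "fa_mult (Poly_Mapping.lookup f) (Poly_Mapping.lookup g) w = Poly_Mapping.lookup (f * g) w"
  proof (induction f rule: poly_mapping_single_induct)
    case (single u c f)
    have "fa_mult (Poly_Mapping.lookup (Poly_Mapping.single u c)) (Poly_Mapping.lookup g) w
        = Poly_Mapping.lookup (Poly_Mapping.single u c * g) w"
    proof (induction g rule: poly_mapping_single_induct)
      case (single v d g)
      \<comment> \<open>Only the cut at \<open>k = length u\<close> can contribute.\<close>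
      have "(\<Sum>k\<le>length w. (c when u = take k w) * (d when v = drop k w)) = (c * d when u @ v = w)"
      proof (cases "u @ v = w")
        case True
        have "u \<noteq> take k w" if "k \<le> length w" "k \<noteq> length u" for k
          using that by (metis length_take min.absorb2)
        then have "(\<Sum>k\<le>length w. (c when u = take k w) * (d when v = drop k w))
            = (\<Sum>k\<in>{length u}. (c when u = take k w) * (d when v = drop k w))"
          using True by (intro sum.mono_neutral_right) auto
        with True show ?thesis by auto
      next
        case False
        then have "(\<Sum>k\<le>length w. (c when u = take k w) * (d when v = drop k w)) = 0"
          by (intro sum.neutral) (auto simp: when_def)
        with False show ?thesis by simp
      qed
      with single show ?case
        by (simp add: fa_mult_def lookup_add lookup_single distrib_left sum.distrib mult_single plus_list_def)
    qed (simp add: fa_mult_def)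
    with single show ?case
      by (simp add: fa_mult_def lookup_add distrib_right sum.distrib)
  qed (simp add: fa_mult_def)
qed

lemma fa_pow_lookup: "fa_pow (Poly_Mapping.lookup f) k = Poly_Mapping.lookup (f ^ k)"
  by (induction k) (simp_all add: fa_one_lookup fa_mult_lookup)

lemma fa_lin_lookup: "fa_lin a = Poly_Mapping.lookup (lin a)"
  by (simp add: fa_lin_def fun_eq_iff fa_var_lookup lin_def lookup_sum lookup_scaleR scaleR_conv_of_real[where 'a = complex])

lemma fa_poly_eval_lookup: "fa_poly_eval p (Poly_Mapping.lookup f) = Poly_Mapping.lookup (alg_eval p f)"
  by (simp add: fa_poly_eval_def fun_eq_iff fa_pow_lookup alg_eval_def lookup_sum lookup_scaleR scaleR_conv_of_real[where 'a = complex])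

lemma lookup_mem_image_iff [simp]: "Poly_Mapping.lookup x \<in> Poly_Mapping.lookup ` I \<longleftrightarrow> x \<in> I"
  by auto

text \<open>Minimality of the generated ideal; complex scalars act as multiplication by
  \<open>const c\<close>.\<close>

lemma fa_ideal_subset:
  assumes "algebra_ideal I" "S \<subseteq> Poly_Mapping.lookup ` I"
  shows "fa_ideal S \<subseteq> Poly_Mapping.lookup ` I"
proof
  interpret algebra_ideal I by fact
  fix f assume "f \<in> fa_ideal S"
  then show "f \<in> Poly_Mapping.lookup ` I"
  proof induction
    case (gen f)
    then show ?case using assms(2) by blast
  next
    case zero
    show ?case unfolding fa_zero_lookup lookup_mem_image_iff by (rule zero_mem)
  next
    case (add f g)
    then show ?case by (auto simp: fa_add_lookup intro: add_mem)
  next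
    case (smult f c)
    then show ?case by (auto simp: fa_smult_lookup intro: mult_left_mem)
  next
    case (mult_left f g)
    then show ?case unfolding range_lookup[symmetric] by (auto simp: fa_mult_lookup intro: mult_left_mem)
  next
    case (mult_right f g)
    then show ?case unfolding range_lookup[symmetric] by (auto simp: fa_mult_lookup intro: mult_right_mem)
  qed
qed

section \<open>The ideal of relations and its minimality\<close>

definition relation_ideal :: "(real^'n::finite \<Rightarrow> real) \<Rightarrow> real^'n \<Rightarrow> 'n free_alg set" where
  "relation_ideal h u = {x. Poly_Mapping.lookup x \<in> J_ideal h u}"

lemma algebra_ideal_relation_ideal: "algebra_ideal (relation_ideal h u)"
proof
  show "0 \<in> relation_ideal h u"
    unfolding relation_ideal_def J_ideal_def using fa_ideal.zero by (simp add: fa_zero_lookup)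
  fix a b c :: "'a free_alg" assume a: "a \<in> relation_ideal h u"
  show "a + b \<in> relation_ideal h u" if "b \<in> relation_ideal h u"
    using a that unfolding relation_ideal_def J_ideal_def
    by (simp add: fa_ideal.add flip: fa_add_lookup)
  show "c * a \<in> relation_ideal h u" "a * c \<in> relation_ideal h u"
    using a unfolding relation_ideal_def J_ideal_def
    by (simp_all add: fa_ideal.mult_left fa_ideal.mult_right flip: fa_mult_lookup)
qed

lemma relation_ideal_gens:
  "alg_eval (hpoly h a u) (lin a) \<in> relation_ideal h u" "1 - lin u \<in> relation_ideal h u"
  unfolding relation_ideal_def J_ideal_def
  by (auto simp flip: fa_poly_eval_lookup fa_sub_lookup fa_one_lookup fa_lin_lookup intro: fa_ideal.gen)

lemma J_ideal_subset:
  assumes "algebra_ideal I" "\<And>a. alg_eval (hpoly h a u) (lin a) \<in> I" "1 - lin u \<in> I"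
  shows "J_ideal h u \<subseteq> Poly_Mapping.lookup ` I"
  unfolding J_ideal_def
proof (rule fa_ideal_subset)
  show "{fa_poly_eval (hpoly h a u) (fa_lin a) |a. True} \<union> {fa_sub fa_one (fa_lin u)} \<subseteq> Poly_Mapping.lookup ` I"
    using assms(2,3) by (auto simp: fa_poly_eval_lookup fa_sub_lookup fa_one_lookup fa_lin_lookup)
qed fact

text \<open>Applied to preimages of ideals under substitutions and the involution, this leaves only
  the generators to be checked.\<close>

lemma relation_ideal_subset:
  assumes "algebra_ideal I" "\<And>a. alg_eval (hpoly h a u) (lin a) \<in> I" "1 - lin u \<in> I"
  shows "relation_ideal h u \<subseteq> I"
  using J_ideal_subset[OF assms] by (auto simp: relation_ideal_def subset_iff)

lemma J_ideal_eq_relation_ideal: "J_ideal h u = Poly_Mapping.lookup ` relation_ideal h u"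
proof
  show "J_ideal h u \<subseteq> Poly_Mapping.lookup ` relation_ideal h u"
    by (rule J_ideal_subset[OF algebra_ideal_relation_ideal relation_ideal_gens])
qed (auto simp: relation_ideal_def)

lemma algebra_ideal_vimage_subst:
  assumes "algebra_ideal I"
  shows "algebra_ideal {x. subst \<sigma> x \<in> I}"
proof -
  interpret algebra_ideal I by fact
  show ?thesis
    by standard (simp_all add: zero_mem add_mem mult_left_mem mult_right_mem subst_add subst_mult)
qed

section \<open>Quotients by ideals stable under the involution\<close>

locale star_ideal = algebra_ideal I for I :: "'n free_alg set" +
  assumes star_mem: "x \<in> I \<Longrightarrow> star x \<in> I"
begin

abbreviation "J \<equiv> Poly_Mapping.lookup ` I"

definition cls where "cls x = qclass J (Poly_Mapping.lookup x)"

lemma cls_eq: "cls x = Poly_Mapping.lookup ` {y. x \<doteq> y}"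
  by (auto simp: cls_def qclass_def eqv_def fa_sub_lookup simp flip: range_lookup)

lemma cls_eq_iff: "cls x = cls y \<longleftrightarrow> x \<doteq> y"
proof
  assume "cls x = cls y"
  then have "Poly_Mapping.lookup y \<in> cls x" by (simp add: cls_eq)
  then show "x \<doteq> y" by (auto simp: cls_eq)
next
  assume "x \<doteq> y"
  then have "{z. x \<doteq> z} = {z. y \<doteq> z}" by (blast intro: eqv_trans eqv_sym)
  then show "cls x = cls y" by (simp add: cls_eq)
qed

lemma qcarrier_eq: "qcarrier J = range cls"
  unfolding qcarrier_def cls_def[abs_def] range_lookup[symmetric] image_image ..

text \<open>The choice in \<open>qrep\<close> is known only up to congruence, so each quotient
  operation is evaluated at a congruent representative.\<close>

lemma qrep_cls: obtains y where "qrep (cls x) = Poly_Mapping.lookup y" "y \<doteq> x"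
proof -
  have "Poly_Mapping.lookup x \<in> cls x" by (simp add: cls_eq)
  then have "qrep (cls x) \<in> cls x" unfolding qrep_def by (rule someI[of "\<lambda>f. f \<in> cls x"])
  then show ?thesis using that by (auto simp: cls_eq intro: eqv_sym)
qed

lemma eqv_star: "x \<doteq> y \<Longrightarrow> star x \<doteq> star y"
  unfolding eqv_def by (simp add: star_mem flip: star_diff)

lemma qadd_cls: "qadd J (cls x) (cls y) = cls (x + y)"
proof -
  obtain x' where x: "qrep (cls x) = Poly_Mapping.lookup x'" "x' \<doteq> x" by (rule qrep_cls)
  obtain y' where y: "qrep (cls y) = Poly_Mapping.lookup y'" "y' \<doteq> y" by (rule qrep_cls)
  have "qadd J (cls x) (cls y) = cls (x' + y')"
    unfolding qadd_def x(1) y(1) fa_add_lookup unfolding cls_def ..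
  then show ?thesis using x(2) y(2) by (simp add: cls_eq_iff eqv_add)
qed

lemma qmult_cls: "qmult J (cls x) (cls y) = cls (x * y)"
proof -
  obtain x' where x: "qrep (cls x) = Poly_Mapping.lookup x'" "x' \<doteq> x" by (rule qrep_cls)
  obtain y' where y: "qrep (cls y) = Poly_Mapping.lookup y'" "y' \<doteq> y" by (rule qrep_cls)
  have "qmult J (cls x) (cls y) = cls (x' * y')"
    unfolding qmult_def x(1) y(1) fa_mult_lookup unfolding cls_def ..
  then show ?thesis using x(2) y(2) by (simp add: cls_eq_iff eqv_mult)
qed

lemma qsmult_cls: "qsmult J c (cls x) = cls (const c * x)"
proof -
  obtain x' where x: "qrep (cls x) = Poly_Mapping.lookup x'" "x' \<doteq> x" by (rule qrep_cls)
  have "qsmult J c (cls x) = cls (const c * x')"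
    unfolding qsmult_def x(1) fa_smult_lookup unfolding cls_def ..
  then show ?thesis using x(2) by (simp add: cls_eq_iff eqv_mult)
qed

lemma qstar_cls: "qstar J (cls x) = cls (star x)"
proof -
  obtain x' where x: "qrep (cls x) = Poly_Mapping.lookup x'" "x' \<doteq> x" by (rule qrep_cls)
  have "qstar J (cls x) = cls (star x')"
    unfolding qstar_def x(1) fa_star_lookup unfolding cls_def ..
  then show ?thesis using x(2) by (simp add: cls_eq_iff eqv_star)
qed

lemma qone_eq: "qone J = cls 1"
  by (simp add: qone_def cls_def fa_one_lookup)

end

text \<open>The involution swaps left and right multiplication, so the preimage of the ideal is
  again two-sided; it contains the generators because they are self-adjoint.\<close>

lemma star_ideal_relation_ideal: "star_ideal (relation_ideal h u)"
proof -
  interpret algebra_ideal "relation_ideal h u" by (rule algebra_ideal_relation_ideal)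
  have "algebra_ideal {x. star x \<in> relation_ideal h u}"
    by standard (simp_all add: zero_mem add_mem mult_left_mem mult_right_mem star_add star_mult)
  then have "relation_ideal h u \<subseteq> {x. star x \<in> relation_ideal h u}"
    by (rule relation_ideal_subset) (simp_all add: star_alg_eval star_diff relation_ideal_gens)
  then show ?thesis by unfold_locales auto
qed

lemma star_alg_iso_subst:
  assumes "star_ideal I" "star_ideal I'"
    and star: "\<And>i. star (\<sigma> i) = \<sigma> i"
    and maps: "\<And>x. x \<in> I \<Longrightarrow> subst \<sigma> x \<in> I'" "\<And>y. y \<in> I' \<Longrightarrow> subst \<tau> y \<in> I"
    and inv: "\<And>i. algebra_ideal.eqv I (subst \<tau> (\<sigma> i)) (var i)"
      "\<And>i. algebra_ideal.eqv I' (subst \<sigma> (\<tau> i)) (var i)"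
  shows "star_alg_iso (Poly_Mapping.lookup ` I) (Poly_Mapping.lookup ` I')"
proof -
  interpret A: star_ideal I by fact
  interpret B: star_ideal I' by fact
  \<comment> \<open>The representative is arbitrary; the choice does not matter because
    \<open>subst \<sigma>\<close> maps \<open>I\<close> into \<open>I'\<close>.\<close>
  define \<Phi> where "\<Phi> X = B.cls (subst \<sigma> (SOME x. X = A.cls x))" for X
  define \<Psi> where "\<Psi> Y = A.cls (subst \<tau> (SOME y. Y = B.cls y))" for Y
  have \<Phi>: "\<Phi> (A.cls x) = B.cls (subst \<sigma> x)" for x
  proof -
    have "A.cls x = A.cls (SOME y. A.cls x = A.cls y)" by (rule someI) (rule refl)
    then show ?thesis unfolding \<Phi>_def B.cls_eq_iff A.cls_eq_iff B.eqv_def A.eqv_def subst_diff[symmetric]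
      using maps(1) A.uminus_mem by fastforce
  qed
  have \<Psi>: "\<Psi> (B.cls y) = A.cls (subst \<tau> y)" for y
  proof -
    have "B.cls y = B.cls (SOME z. B.cls y = B.cls z)" by (rule someI) (rule refl)
    then show ?thesis unfolding \<Psi>_def B.cls_eq_iff A.cls_eq_iff B.eqv_def A.eqv_def subst_diff[symmetric]
      using maps(2) B.uminus_mem by fastforce
  qed
  have "\<Psi> (\<Phi> (A.cls x)) = A.cls x" for x
    unfolding \<Phi> \<Psi> A.cls_eq_iff subst_subst by (rule subst_eqv_self[OF A.algebra_ideal_axioms inv(1)])
  moreover have "\<Phi> (\<Psi> (B.cls y)) = B.cls y" for y
    unfolding \<Phi> \<Psi> B.cls_eq_iff subst_subst by (rule subst_eqv_self[OF B.algebra_ideal_axioms inv(2)])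
  ultimately have "bij_betw \<Phi> (qcarrier A.J) (qcarrier B.J)"
    unfolding A.qcarrier_eq B.qcarrier_eq
    by (intro bij_betw_byWitness[where f' = \<Psi>]) (auto simp: \<Phi> \<Psi>)
  then show ?thesis
    unfolding star_alg_iso_def
    by (intro exI[of _ \<Phi>])
       (auto simp: A.qcarrier_eq \<Phi> A.qadd_cls B.qadd_cls A.qmult_cls B.qmult_cls A.qsmult_cls B.qsmult_cls
         A.qstar_cls B.qstar_cls A.qone_eq B.qone_eq subst_add subst_mult star_subst[OF star])
qed

section \<open>The isomorphism\<close>

theorem theorem2p6:
  fixes h :: "real^'n::finite \<Rightarrow> real" and e e' :: "real^'n"
  assumes "homogeneous_polynomial h"
    and "hyperbolic h e"
    and "e' \<in> hyp_cone_interior h e"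
  shows "star_alg_iso (J_ideal h e') (J_ideal h e)"
proof -
  interpret E: star_ideal "relation_ideal h e" by (rule star_ideal_relation_ideal)
  interpret E': star_ideal "relation_ideal h e'" by (rule star_ideal_relation_ideal)
  have E_rel: "E.eqv (alg_eval (hpoly h a e) (lin a)) 0" and E'_rel: "E'.eqv (alg_eval (hpoly h a e') (lin a)) 0" for a
    by (simp_all add: E.eqv_0_iff E'.eqv_0_iff relation_ideal_gens)
  have E_one: "E.eqv (lin e) 1"
    by (rule E.eqv_sym) (simp add: E.eqv_def relation_ideal_gens)
  have E'_one: "E'.eqv (lin e') 1"
    by (rule E'.eqv_sym) (simp add: E'.eqv_def relation_ideal_gens)

  define p where "p = hpoly h e' e"
  obtain q where q: "p dvd q ^ 2 * [:0, 1:] - 1"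
    using assms(3) inverse_sqrt_modulo[of p] by (auto simp: hyp_cone_interior_def p_def)

  define b where "b = lin e'"
  define Q where "Q = alg_eval q b"
  have QQb: "E.eqv (Q * Q * b) 1"
    unfolding Q_def by (rule E.inverse_sqrt_eqv[OF q]) (simp add: E_rel p_def b_def)
  have Qb: "Q * b = b * Q" unfolding Q_def by (rule alg_eval_commute)
  define \<sigma> where "\<sigma> i = Q * var i * Q" for i
  have \<sigma>_lin: "subst \<sigma> (lin a) = Q * lin a * Q" for a
    unfolding \<sigma>_def by (rule subst_lin_sandwich)
  have \<sigma>_mem: "subst \<sigma> x \<in> relation_ideal h e" if "x \<in> relation_ideal h e'" for x
  proof -
    have "relation_ideal h e' \<subseteq> {x. subst \<sigma> x \<in> relation_ideal h e}"
    proof (rule relation_ideal_subset, rule algebra_ideal_vimage_subst, rule E.algebra_ideal_axioms)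
      show "alg_eval (hpoly h a e') (lin a) \<in> {x. subst \<sigma> x \<in> relation_ideal h e}" for a
        using E.hpoly_eqv_sandwich[OF assms(1) linear_lin E_rel, of Q e' a] QQb Qb
        by (simp add: subst_alg_eval \<sigma>_lin E.eqv_0_iff b_def)
      have "E.eqv (Q * b * Q) 1" using QQb by (metis Qb mult.assoc)
      then show "1 - lin e' \<in> {x. subst \<sigma> x \<in> relation_ideal h e}"
        using E.eqv_sym by (simp add: subst_diff \<sigma>_lin b_def flip: E.eqv_def)
    qed
    with that show ?thesis by blast
  qed

  define b' where "b' = lin e"
  \<comment> \<open>The constant term is h(e), so \<open>b'\<close> is invertible modulo the
    relations in direction \<open>e'\<close>.\<close>
  have "poly (hpoly h e e') 0 \<noteq> 0"
    using assms(2) by (simp add: poly_hpoly[OF assms(1)] hyperbolic_def)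
  then obtain r where r: "E'.eqv (alg_eval r b' * b') 1"
    unfolding b'_def by (rule E'.alg_eval_root_inverse[OF _ E'_rel])
  define c where "c = alg_eval r b'"
  have cb': "E'.eqv (c * b') 1" using r by (simp add: c_def)
  \<comment> \<open>Inverting \<open>b'\<close> turns the relation for \<open>e'\<close> into one in
    direction \<open>e\<close>, satisfied by \<open>c * lin e'\<close>; as this is congruent to
    \<open>c\<close>, the polynomial \<open>p\<close> annihilates \<open>c\<close>.\<close>
  have "E'.eqv (c * lin e') c"
    using E'.eqv_mult[OF E'.eqv_refl E'_one, of c] by simp
  then have "E'.eqv (alg_eval p c) (alg_eval p (c * lin e'))"
    by (rule E'.eqv_alg_eval[OF E'.eqv_sym])
  also have "E'.eqv \<dots> 0"
    unfolding p_def using cb' by (intro E'.hpoly_eqv_inverse[OF assms(1) linear_lin E'_rel]) (simp add: b'_def)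
  finally have qqc: "E'.eqv (alg_eval q c * alg_eval q c * c) 1"
    by (rule E'.inverse_sqrt_eqv[OF q])
  have qc: "alg_eval q c * c = c * alg_eval q c" by (rule alg_eval_commute)
  have "c * b' = b' * c" unfolding c_def by (rule alg_eval_commute)
  then have qb': "alg_eval q c * b' = b' * alg_eval q c" by (rule alg_eval_commute_left)
  \<comment> \<open>Since q(c)^2 c is congruent to 1, R^2 is congruent to \<open>c\<close>, and
    \<open>alg_eval q c\<close> is the inverse of \<open>R\<close>.\<close>
  define R where "R = alg_eval q c * c"
  have Rb': "R * b' = b' * R"
    unfolding R_def by (metis \<open>c * b' = b' * c\<close> mult.assoc qb')
  have "R * R = alg_eval q c * (c * alg_eval q c) * c"
    by (simp only: R_def mult.assoc)
  then have RR_eq: "R * R = alg_eval q c * alg_eval q c * c * c"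
    by (simp add: mult.assoc flip: qc)
  then have "R * R * b' = (alg_eval q c * alg_eval q c * c) * (c * b')"
    by (simp only: mult.assoc)
  also have "E'.eqv \<dots> (1 * 1)" by (intro E'.eqv_mult qqc cb')
  finally have RRb': "E'.eqv (R * R * b') 1" by simp
  note RR_eq
  also have "E'.eqv (alg_eval q c * alg_eval q c * c * c) (1 * c)" by (intro E'.eqv_mult qqc E'.eqv_refl)
  finally have RR: "E'.eqv (R * R) c" by simp
  define \<tau> where "\<tau> i = R * var i * R" for i
  have \<tau>_lin: "subst \<tau> (lin a) = R * lin a * R" for a
    unfolding \<tau>_def by (rule subst_lin_sandwich)
  have \<tau>_mem: "subst \<tau> x \<in> relation_ideal h e'" if "x \<in> relation_ideal h e" for x
  proof -
    have "relation_ideal h e \<subseteq> {x. subst \<tau> x \<in> relation_ideal h e'}"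
    proof (rule relation_ideal_subset, rule algebra_ideal_vimage_subst, rule E'.algebra_ideal_axioms)
      show "alg_eval (hpoly h a e) (lin a) \<in> {x. subst \<tau> x \<in> relation_ideal h e'}" for a
        using E'.hpoly_eqv_sandwich[OF assms(1) linear_lin E'_rel, of R e a] RRb' Rb'
        by (simp add: subst_alg_eval \<tau>_lin E'.eqv_0_iff b'_def)
      have "E'.eqv (R * b' * R) 1" using RRb' by (metis Rb' mult.assoc)
      then show "1 - lin e \<in> {x. subst \<tau> x \<in> relation_ideal h e'}"
        using E'.eqv_sym by (simp add: subst_diff \<tau>_lin b'_def flip: E'.eqv_def)
    qed
    with that show ?thesis by blast
  qed

  \<comment> \<open>The image of \<open>b\<close> under \<open>subst \<tau>\<close> is congruent to
    R^2, hence to \<open>c\<close>, so that of \<open>Q\<close> is congruent to q(c) and cancels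
    \<open>R\<close> on both sides.\<close>
  have "E'.eqv (subst \<tau> (\<sigma> i)) (var i)" for i
  proof -
    have "E'.eqv (R * lin e' * R) (R * 1 * R)"
      by (intro E'.eqv_mult E'.eqv_refl E'_one)
    then have "E'.eqv (subst \<tau> b) c"
      using E'.eqv_trans RR by (simp add: b_def \<tau>_lin)
    then have \<tau>_Q: "E'.eqv (subst \<tau> Q) (alg_eval q c)"
      unfolding Q_def subst_alg_eval by (rule E'.eqv_alg_eval)
    have "E'.eqv (subst \<tau> Q * R) (alg_eval q c * R)"
      by (intro E'.eqv_mult E'.eqv_refl \<tau>_Q)
    also have "alg_eval q c * R = alg_eval q c * alg_eval q c * c"
      by (simp only: R_def mult.assoc)
    also note qqc
    finally have 1: "E'.eqv (subst \<tau> Q * R) 1" .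
    have "E'.eqv (R * subst \<tau> Q) (R * alg_eval q c)"
      by (intro E'.eqv_mult E'.eqv_refl \<tau>_Q)
    also have "R * alg_eval q c = alg_eval q c * alg_eval q c * c"
      by (simp add: R_def mult.assoc flip: qc)
    also note qqc
    finally have 2: "E'.eqv (R * subst \<tau> Q) 1" .
    show ?thesis
      using E'.eqv_sandwich_cancel[OF 1 2, of "var i"] by (simp add: \<sigma>_def subst_mult \<tau>_def)
  qed
  \<comment> \<open>Applying \<open>subst \<sigma>\<close> to c b' = 1 gives C Q^2 = 1 modulo the
    ideal, as \<open>lin e\<close> is congruent to 1. Hence \<open>C\<close> is congruent to
    \<open>b\<close>, and the image of \<open>R\<close> to \<open>Q * b\<close>, the inverse of
    \<open>Q\<close>.\<close>
  moreover have "E.eqv (subst \<sigma> (\<tau> i)) (var i)" for i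
  proof -
    define C where "C = subst \<sigma> c"
    have "subst \<sigma> (c * b' - 1) \<in> relation_ideal h e"
      using cb' by (intro \<sigma>_mem) (simp add: E'.eqv_def)
    then have 0: "E.eqv (C * (Q * b' * Q)) 1"
      by (simp add: subst_diff subst_mult E.eqv_def b'_def \<sigma>_lin C_def)
    have "E.eqv (C * (Q * 1 * Q)) (C * (Q * b' * Q))"
      unfolding b'_def by (intro E.eqv_mult E.eqv_refl E.eqv_sym[OF E_one])
    from E.eqv_trans[OF this 0] have "E.eqv (C * (Q * Q)) 1" by simp
    then have C: "E.eqv C b" using QQb by (rule E.eqv_inverse_unique)
    have "subst \<sigma> R = alg_eval q C * C"
      by (simp add: R_def C_def subst_mult subst_alg_eval)
    also have "E.eqv \<dots> (Q * b)"
      unfolding Q_def by (intro E.eqv_mult E.eqv_alg_eval C)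
    finally have \<sigma>_R: "E.eqv (subst \<sigma> R) (Q * b)" .
    have "E.eqv (subst \<sigma> R * Q) (Q * b * Q)"
      by (intro E.eqv_mult E.eqv_refl \<sigma>_R)
    also have "Q * b * Q = Q * Q * b"
      by (simp add: mult.assoc flip: Qb)
    also note QQb
    finally have 1: "E.eqv (subst \<sigma> R * Q) 1" .
    have "E.eqv (Q * subst \<sigma> R) (Q * (Q * b))"
      by (intro E.eqv_mult E.eqv_refl \<sigma>_R)
    also have "Q * (Q * b) = Q * Q * b"
      by (simp only: mult.assoc)
    also note QQb
    finally have 2: "E.eqv (Q * subst \<sigma> R) 1" .
    show ?thesis
      using E.eqv_sandwich_cancel[OF 1 2, of "var i"] by (simp add: \<sigma>_def subst_mult \<tau>_def)
  qed
  \<comment> \<open>\<open>Q\<close> is self-adjoint, being a real polynomial in the self-adjoint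
    element \<open>b\<close>.\<close>
  moreover have "star (\<sigma> i) = \<sigma> i" for i
    by (simp add: \<sigma>_def Q_def b_def star_mult star_alg_eval mult.assoc)
  ultimately show ?thesis
    unfolding J_ideal_eq_relation_ideal
    by (intro star_alg_iso_subst[where \<sigma> = \<sigma> and \<tau> = \<tau>] E.star_ideal_axioms E'.star_ideal_axioms \<sigma>_mem \<tau>_mem)
qed

end
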